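(* Let $m\geq 1$ be an integer. Every graph $G$ in the family $\mathcal{B}_m$ is an ASR-graph with domination number $\gamma(G)=m$.
   Context: $\gamma(G)$ denotes the domination number of a finite simple graph $G$. For an edge $e=uv$ of $G$, $G-e$ is the graph obtained by deleting $e$, and $G_e$ is the graph obtained by subdividing $e$: delete $e$, add a new vertex $w$ and the edges $uw$ and $wv$. A finite connected simple graph $G$ of order at least two is an ASR-graph (anti-sub-removable graph) if $\gamma(G-e)\neq\gamma(G_e)$ for every edge $e$ of $G$. A universal vertex is a vertex adjacent to all other vertices of the graph. For vertex-disjoint graphs $G$ and $H$, the sum $G+H$ is the graph with vertex set $V(G)\cup V(H)$ and edge set $E(G)\cup E(H)\cup\{xy: x\in V(G),\ y\in V(H)\}$. For a graph $H$ and $X\subseteq V(H)$, $H[X]$ is the subgraph induced by $X$, and $N_H[X]$ is the set of vertices of $H$ that are in $X$ or adjacent to a vertex of $X$. For vertex-disjoint graphs $F_1,\dots,F_m$, $E(F_1,\dots,F_m)$ denotes the set of all possible edges between different $F_i$'s, i.e. the edge set of the complete $m$-partite graph with parts $V(F_1),\dots,V(F_m)$. Definition of $\mathcal{B}_m$: a finite connected simple graph $G$ belongs to $\mathcal{B}_m$ if there exist $m$ vertex-disjoint ASR-graphs $G_1,\dots,G_m$, each of order at least three and with domination number one, such that $V(G)=\bigcup_{i=1}^m V(G_i)$ and $E(G)=\bigcup_{i=1}^m E(G_i)\cup\widetilde{E}(G)$, where: - for $1\le i\le m$, $G_i=K_{r_i}+H_i$, where $r_i$ is the number of universal vertices of $G_i$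 (so $K_{r_i}$ is induced by the universal vertices and $H_i$ by the remaining vertices; $H_i$ need not be connected); - for $1\le i\le m$, $S_i$ is a subset of $V(H_i)$ such that $N_{H_i}[S_i]\neq V(H_i)$; - $\widetilde{E}(G)\subseteq E(H_1[S_1],H_2[S_2],\dots,H_m[S_m])$. *)

theory Defs
  imports Main
begin

record 'a sgraph =
  verts :: "'a set"
  edges :: "'a set set"

definition finite_simple_graph :: "'a sgraph \<Rightarrow> bool" where
  "finite_simple_graph G \<longleftrightarrow>
     finite (verts G) \<and> (\<forall>e\<in>edges G. e \<subseteq> verts G \<and> card e = 2)"

definition adj :: "'a sgraph \<Rightarrow> 'a \<Rightarrow> 'a \<Rightarrow> bool" where
  "adj G u v \<longleftrightarrow> {u, v} \<in> edges G"

definition connected_graph :: "'a sgraph \<Rightarrow> bool" where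
  "connected_graph G \<longleftrightarrow>
     verts G \<noteq> {} \<and> (\<forall>u\<in>verts G. \<forall>v\<in>verts G. (adj G)\<^sup>*\<^sup>* u v)"

definition closed_nbhd :: "'a sgraph \<Rightarrow> 'a set \<Rightarrow> 'a set" where
  "closed_nbhd G X = {v \<in> verts G. v \<in> X \<or> (\<exists>x\<in>X. adj G x v)}"

definition dominating :: "'a sgraph \<Rightarrow> 'a set \<Rightarrow> bool" where
  "dominating G D \<longleftrightarrow> D \<subseteq> verts G \<and> closed_nbhd G D = verts G"

definition domination_number :: "'a sgraph \<Rightarrow> nat" where
  "domination_number G = (LEAST k. \<exists>D. dominating G D \<and> card D = k)"

definition delete_edge :: "'a sgraph \<Rightarrow> 'a set \<Rightarrow> 'a sgraph" where
  "delete_edge G e = \<lparr>verts = verts G, edges = edges G - {e}\<rparr>"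

(* The new vertex is None; the old vertices are embedded by Some, so that
   a fresh vertex exists whatever the vertex type is. *)
definition subdivide_edge :: "'a sgraph \<Rightarrow> 'a set \<Rightarrow> 'a option sgraph" where
  "subdivide_edge G e =
     \<lparr>verts = insert None (Some ` verts G),
      edges = (\<lambda>f. Some ` f) ` (edges G - {e}) \<union> {{Some u, None} | u. u \<in> e}\<rparr>"

(* anti-sub-removable *)
definition ASR_graph :: "'a sgraph \<Rightarrow> bool" where
  "ASR_graph G \<longleftrightarrow>
     finite_simple_graph G \<and> connected_graph G \<and> card (verts G) \<ge> 2 \<and>
     (\<forall>e\<in>edges G. domination_number (delete_edge G e) \<noteq> domination_number (subdivide_edge G e))"

definition universal_verts :: "'a sgraph \<Rightarrow> 'a set" where
  "universal_verts G = {v \<in> verts G. \<forall>u\<in>verts G. u \<noteq> v \<longrightarrow> adj G v u}"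

definition complete_graph :: "'a set \<Rightarrow> 'a sgraph" where
  "complete_graph U = \<lparr>verts = U, edges = {{x, y} | x y. x \<in> U \<and> y \<in> U \<and> x \<noteq> y}\<rparr>"

(* used only for vertex-disjoint graphs *)
definition graph_sum :: "'a sgraph \<Rightarrow> 'a sgraph \<Rightarrow> 'a sgraph" where
  "graph_sum G H =
     \<lparr>verts = verts G \<union> verts H,
      edges = edges G \<union> edges H \<union> {{x, y} | x y. x \<in> verts G \<and> y \<in> verts H}\<rparr>"

definition induced :: "'a sgraph \<Rightarrow> 'a set \<Rightarrow> 'a sgraph" where
  "induced H X = \<lparr>verts = X, edges = {e \<in> edges H. e \<subseteq> X}\<rparr>"

definition edges_between :: "'i set \<Rightarrow> ('i \<Rightarrow> 'a sgraph) \<Rightarrow> 'a set set" where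
  "edges_between I F =
     {{x, y} | x y. \<exists>i\<in>I. \<exists>j\<in>I. i \<noteq> j \<and> x \<in> verts (F i) \<and> y \<in> verts (F j)}"

(* F i, H i, S i are the G_i, H_i, S_i and E' is the set of additional edges.
   In F i = K + H i the complete summand K is on the set of all universal
   vertices of F i, so H i is induced by the remaining vertices. *)
definition family_B :: "nat \<Rightarrow> 'a sgraph set" where
  "family_B m = {G. finite_simple_graph G \<and> connected_graph G \<and>
     (\<exists>(F :: nat \<Rightarrow> 'a sgraph) (H :: nat \<Rightarrow> 'a sgraph) (S :: nat \<Rightarrow> 'a set) (E' :: 'a set set).
        (\<forall>i\<in>{1..m}. ASR_graph (F i) \<and> card (verts (F i)) \<ge> 3 \<and> domination_number (F i) = 1) \<and>
        (\<forall>i\<in>{1..m}. \<forall>j\<in>{1..m}. i \<noteq> j \<longrightarrow> verts (F i) \<inter> verts (F j) = {}) \<and>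
        verts G = (\<Union>i\<in>{1..m}. verts (F i)) \<and>
        edges G = (\<Union>i\<in>{1..m}. edges (F i)) \<union> E' \<and>
        (\<forall>i\<in>{1..m}. finite_simple_graph (H i) \<and>
           universal_verts (F i) \<inter> verts (H i) = {} \<and>
           F i = graph_sum (complete_graph (universal_verts (F i))) (H i)) \<and>
        (\<forall>i\<in>{1..m}. S i \<subseteq> verts (H i) \<and> closed_nbhd (H i) (S i) \<noteq> verts (H i)) \<and>
        E' \<subseteq> edges_between {1..m} (\<lambda>i. induced (H i) (S i)))}"

end

theory Submission
  imports Defs
begin

text \<open>
  An ASR-graph with domination number one and order at least three has, for each of its edges,
  a universal vertex that is not an end of that edge. The universal vertices of the parts are
  adjacent to nothing outside their part, so every dominating set of \<open>G\<close>, and of \<open>G\<close> with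
  an edge \<open>e\<close> subdivided, meets each part; and the universal vertices avoiding \<open>e\<close>
  dominate \<open>G - e\<close> with \<open>m\<close> vertices. If \<open>m\<close> vertices dominated the subdivision,
  there would be exactly one in each part and the subdivision vertex would not be one of them. A
  vertex of \<open>H\<^sub>i\<close> outside \<open>N[S\<^sub>i]\<close> can only be dominated from within its part, so the
  vertex chosen there is not in \<open>S\<^sub>i\<close>. The new vertex forces an end \<open>u\<close> of \<open>e\<close> to be
  chosen, so \<open>e = uv\<close> lies inside a part, and then nothing is left to dominate \<open>v\<close>.
\<close>

section \<open>Adjacency and edges in finite simple graphs\<close>

lemma adj_commute: "adj G x y \<longleftrightarrow> adj G y x"
  by (simp add: adj_def insert_commute)

lemma adj_verts:
  assumes "finite_simple_graph G" "adj G x y"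
  shows "x \<in> verts G" "y \<in> verts G" "x \<noteq> y"
  using assms by (force simp: finite_simple_graph_def adj_def)+

lemma edge_cases:
  assumes "finite_simple_graph G" "e \<in> edges G"
  obtains x y where "e = {x, y}" "x \<noteq> y" "x \<in> verts G" "y \<in> verts G" "adj G x y"
proof -
  have "card e = 2" "e \<subseteq> verts G"
    using assms by (auto simp: finite_simple_graph_def)
  then show thesis
    using assms(2) that by (auto simp: card_2_iff adj_def)
qed

lemma edge_other_end:
  assumes "finite_simple_graph G" "e \<in> edges G" "u \<in> e"
  obtains v where "e = {u, v}" "u \<noteq> v" "u \<in> verts G" "v \<in> verts G" "adj G u v"
proof -
  obtain x y where xy: "e = {x, y}" "x \<noteq> y" "x \<in> verts G" "y \<in> verts G" "adj G x y"
    using edge_cases[OF assms(1,2)] .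
  moreover have "e = {y, x}" "adj G y x"
    using xy by (auto simp: adj_commute)
  ultimately show thesis
    using that[of x] that[of y] assms(3) by blast
qed

section \<open>Dominating sets and the domination number\<close>

lemma dominating_iff:
  "dominating G D \<longleftrightarrow> D \<subseteq> verts G \<and> (\<forall>v\<in>verts G. v \<in> D \<or> (\<exists>x\<in>D. adj G x v))"
  by (auto simp: dominating_def closed_nbhd_def)

lemma domination_number_le: "dominating G D \<Longrightarrow> domination_number G \<le> card D"
  unfolding domination_number_def by (rule Least_le) blast

text \<open>The whole vertex set dominates, so the \<open>LEAST\<close> is taken over a nonempty set
  of cardinalities.\<close>

lemma domination_number_attained:
  obtains D where "dominating G D" "card D = domination_number G"
proof -
  have "dominating G (verts G)"
    by (simp add: dominating_iff)
  then have "\<exists>k D. dominating G D \<and> card D = k"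
    by blast
  then have "\<exists>D. dominating G D \<and> card D = domination_number G"
    unfolding domination_number_def by (rule LeastI_ex)
  then show thesis
    using that by blast
qed

lemma domination_number_ge: "(\<And>D. dominating G D \<Longrightarrow> k \<le> card D) \<Longrightarrow> k \<le> domination_number G"
  by (metis domination_number_attained)

lemma dominating_singleton_iff: "dominating G {u} \<longleftrightarrow> u \<in> universal_verts G"
  by (auto simp: dominating_iff universal_verts_def)

lemma universal_vert_exists:
  assumes "domination_number G = 1"
  shows "\<exists>u. u \<in> universal_verts G"
proof -
  obtain D where "dominating G D" "card D = 1"
    using domination_number_attained assms by metis
  then show ?thesis
    by (auto simp: card_1_singleton_iff dominating_singleton_iff)
qed

text \<open>A dominating singleton would consist of a universal vertex, and the empty set dominates
  no vertex.\<close>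

lemma domination_number_eq_2:
  assumes "finite (verts G)" "verts G \<noteq> {}" "universal_verts G = {}" "dominating G {x, y}"
  shows "domination_number G = 2"
proof (rule antisym)
  show "domination_number G \<le> 2"
    using domination_number_le[OF assms(4)] by (auto simp: card_insert_if split: if_splits)
  show "2 \<le> domination_number G"
  proof (rule domination_number_ge, rule ccontr)
    fix D assume D: "dominating G D" and "\<not> 2 \<le> card D"
    moreover have "finite D" "D \<noteq> {}"
      using D assms(1,2) by (auto simp: dominating_iff intro: finite_subset)
    ultimately have "card D = 1"
      by (metis One_nat_def Suc_leI card_gt_0_iff le_antisym not_less_eq_eq numeral_2_eq_2)
    then show False
      using D assms(3) by (auto simp: card_1_singleton_iff dominating_singleton_iff)
  qed
qed

section \<open>Deletion and subdivision of an edge, and what the ASR condition forces when the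
  domination number is one\<close>

lemma verts_delete_edge [simp]: "verts (delete_edge G e) = verts G"
  by (simp add: delete_edge_def)

lemma adj_delete_edge [simp]: "adj (delete_edge G e) x y \<longleftrightarrow> adj G x y \<and> {x, y} \<noteq> e"
  by (auto simp: delete_edge_def adj_def)

lemma verts_subdivide_edge [simp]: "verts (subdivide_edge G e) = insert None (Some ` verts G)"
  by (simp add: subdivide_edge_def)

lemma adj_subdivide_edge_Some [simp]:
  "adj (subdivide_edge G e) (Some x) (Some y) \<longleftrightarrow> adj G x y \<and> {x, y} \<noteq> e"
proof -
  have "{Some x, Some y} = Some ` f \<longleftrightarrow> f = {x, y}" for f
    using inj_image_eq_iff[of Some "{x, y}" f] by auto
  then have "{Some x, Some y} \<in> (`) Some ` (edges G - {e}) \<longleftrightarrow> {x, y} \<in> edges G - {e}"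
    by (auto simp: image_iff)
  moreover have "{Some x, Some y} \<noteq> {Some u, None}" for u
    by (metis insertCI insertE option.distinct(1) singletonD)
  ultimately show ?thesis
    unfolding adj_def subdivide_edge_def by simp
qed

lemma adj_subdivide_edge_None [simp]: "adj (subdivide_edge G e) (Some x) None \<longleftrightarrow> x \<in> e"
proof -
  have "{Some x, None} \<noteq> Some ` f" for f
    by (metis imageE insertCI option.distinct(1))
  moreover have "{Some x, None} = {Some u, None} \<longleftrightarrow> u = x" for u
    by (auto simp: doubleton_eq_iff)
  ultimately show ?thesis
    unfolding adj_def subdivide_edge_def by auto
qed

lemma adj_subdivide_edge_None' [simp]: "adj (subdivide_edge G e) None (Some x) \<longleftrightarrow> x \<in> e"
  using adj_commute adj_subdivide_edge_None by metis

text \<open>If all universal vertices were ends of \<open>e\<close>, the two ends would dominate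
  both modified graphs, while neither of these would have a universal vertex. Both domination
  numbers would be 2, against the ASR condition.\<close>

lemma universal_vert_avoiding_edge:
  assumes "ASR_graph G" "card (verts G) \<ge> 3" "domination_number G = 1" "e \<in> edges G"
  shows "\<exists>u\<in>universal_verts G. u \<notin> e"
proof (rule ccontr)
  assume "\<not> ?thesis"
  then have univ_in_e: "w \<in> e" if "w \<in> universal_verts G" for w
    using that by blast
  have G: "finite_simple_graph G" and
    neq: "domination_number (delete_edge G e) \<noteq> domination_number (subdivide_edge G e)"
    using assms(1,4) by (auto simp: ASR_graph_def)
  have fin: "finite (verts G)"
    using G by (simp add: finite_simple_graph_def)
  obtain x y where e: "e = {x, y}" "x \<noteq> y" "x \<in> verts G" "y \<in> verts G" "adj G x y"
    using edge_cases[OF G assms(4)] .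
  obtain u where u: "u \<in> universal_verts G"
    using universal_vert_exists assms(3) by blast
  have e_adj: "a \<in> e \<or> adj G u a" if "a \<in> verts G" for a
    using that u univ_in_e[OF u] by (cases "a = u") (auto simp: universal_verts_def)
  have u_or: "u = x \<or> u = y"
    using univ_in_e[OF u] e by auto
  have "domination_number (delete_edge G e) = 2"
  proof (rule domination_number_eq_2)
    show "universal_verts (delete_edge G e) = {}"
    proof (rule ccontr)
      assume "universal_verts (delete_edge G e) \<noteq> {}"
      then obtain w where w: "w \<in> universal_verts (delete_edge G e)"
        by blast
      \<comment> \<open>Such a vertex is universal in \<open>G\<close> as well, so it is an end of
        \<open>e\<close>; but deletion has separated it from the other end.\<close>
      then have "w \<in> e"
        by (intro univ_in_e) (auto simp: universal_verts_def)
      then show False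
        using w e by (auto simp: universal_verts_def insert_commute)
    qed
    show "dominating (delete_edge G e) {x, y}"
      using e e_adj u_or by (auto simp: dominating_iff doubleton_eq_iff)
  qed (use fin e in auto)
  moreover have "domination_number (subdivide_edge G e) = 2"
  proof (rule domination_number_eq_2)
    show "universal_verts (subdivide_edge G e) = {}"
    proof (rule ccontr)
      assume "universal_verts (subdivide_edge G e) \<noteq> {}"
      then obtain w where w: "w \<in> universal_verts (subdivide_edge G e)"
        by blast
      show False
      proof (cases w)
        case None
        \<comment> \<open>The subdivision vertex sees only the ends of \<open>e\<close>, and
          \<open>G\<close> has at least three vertices.\<close>
        then have "verts G \<subseteq> {x, y}"
          using w e by (auto simp: universal_verts_def)
        then have "card (verts G) \<le> 2"
          using card_mono[of "{x, y}" "verts G"] e by simp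
        then show False
          using assms(2) by simp
      next
        case (Some a)
        \<comment> \<open>Seeing \<open>None\<close> makes \<open>a\<close> an end of
          \<open>e\<close>, and it no longer sees the other end.\<close>
        then have "a \<in> e"
          using w by (auto simp: universal_verts_def)
        then show False
          using w e Some by (auto simp: universal_verts_def insert_commute)
      qed
    qed
    show "dominating (subdivide_edge G e) {Some x, Some y}"
      using e e_adj u_or by (auto simp: dominating_iff doubleton_eq_iff)
  qed (use fin in auto)
  ultimately show False
    using neq by simp
qed

text \<open>Disjointness makes any choice of representatives injective. This yields the lower bounds
  on dominating sets that meet every part.\<close>

lemma disjoint_family_transversal:
  assumes "finite D" "\<And>i. i \<in> I \<Longrightarrow> D \<inter> A i \<noteq> {}"
    and "\<And>i j. i \<in> I \<Longrightarrow> j \<in> I \<Longrightarrow> i \<noteq> j \<Longrightarrow> A i \<inter> A j = {}"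
  obtains d where "\<forall>i\<in>I. d i \<in> A i" "d ` I \<subseteq> D" "card (d ` I) = card I"
proof -
  have "\<forall>i\<in>I. \<exists>x. x \<in> D \<inter> A i"
    using assms(2) by blast
  then obtain d where d: "\<forall>i\<in>I. d i \<in> D \<inter> A i"
    by metis
  moreover have "inj_on d I"
    using d assms(3) by (fastforce intro: inj_onI)
  ultimately show thesis
    using that[of d] card_image by blast
qed

section \<open>Domination in a graph with a fixed decomposition into parts \<open>F i\<close> linked
  by \<open>E'\<close>\<close>

locale B_decomposition =
  fixes m :: nat and G :: "'a sgraph" and F H :: "nat \<Rightarrow> 'a sgraph"
    and S :: "nat \<Rightarrow> 'a set" and E' :: "'a set set"
  assumes simple_G: "finite_simple_graph G"
    and F_ASR: "\<And>i. i \<in> {1..m} \<Longrightarrow> ASR_graph (F i)"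
    and F_card: "\<And>i. i \<in> {1..m} \<Longrightarrow> card (verts (F i)) \<ge> 3"
    and F_dom: "\<And>i. i \<in> {1..m} \<Longrightarrow> domination_number (F i) = 1"
    and F_disjoint: "\<And>i j. i \<in> {1..m} \<Longrightarrow> j \<in> {1..m} \<Longrightarrow> i \<noteq> j \<Longrightarrow>
      verts (F i) \<inter> verts (F j) = {}"
    and verts_G: "verts G = (\<Union>i\<in>{1..m}. verts (F i))"
    and edges_G: "edges G = (\<Union>i\<in>{1..m}. edges (F i)) \<union> E'"
    and univ_H: "\<And>i. i \<in> {1..m} \<Longrightarrow> universal_verts (F i) \<inter> verts (H i) = {}"
    and F_sum: "\<And>i. i \<in> {1..m} \<Longrightarrow>
      F i = graph_sum (complete_graph (universal_verts (F i))) (H i)"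
    and S_subset: "\<And>i. i \<in> {1..m} \<Longrightarrow> S i \<subseteq> verts (H i)"
    and S_nbhd: "\<And>i. i \<in> {1..m} \<Longrightarrow> closed_nbhd (H i) (S i) \<noteq> verts (H i)"
    and E'_subset: "E' \<subseteq> edges_between {1..m} (\<lambda>i. induced (H i) (S i))"
begin

lemma simple_F: "i \<in> {1..m} \<Longrightarrow> finite_simple_graph (F i)"
  using F_ASR by (simp add: ASR_graph_def)

lemma verts_F: "i \<in> {1..m} \<Longrightarrow> verts (F i) = universal_verts (F i) \<union> verts (H i)"
  using arg_cong[OF F_sum, of i verts] by (simp add: graph_sum_def complete_graph_def)

lemma S_in_F: "i \<in> {1..m} \<Longrightarrow> x \<in> S i \<Longrightarrow> x \<in> verts (F i)"
  using S_subset verts_F by blast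

text \<open>Every edge of the sum that is not an edge of \<open>H i\<close> has a universal vertex
  as an end.\<close>

lemma adj_H_if_adj_F:
  assumes i: "i \<in> {1..m}" and x: "x \<in> verts (H i)" and y: "y \<in> verts (H i)" and "adj (F i) x y"
  shows "adj (H i) x y"
proof -
  have "{x, y} \<in> edges (graph_sum (complete_graph (universal_verts (F i))) (H i))"
    using assms F_sum[OF i] by (simp add: adj_def)
  moreover have "x \<notin> universal_verts (F i)" "y \<notin> universal_verts (F i)"
    using univ_H[OF i] x y by auto
  ultimately show ?thesis
    by (auto simp: graph_sum_def complete_graph_def adj_def doubleton_eq_iff)
qed

lemma E'_cases:
  assumes "e \<in> E'"
  obtains i j x y where "i \<in> {1..m}" "j \<in> {1..m}" "i \<noteq> j" "x \<in> S i" "y \<in> S j" "e = {x, y}"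
proof -
  have "e \<in> edges_between {1..m} (\<lambda>i. induced (H i) (S i))"
    using assms E'_subset by blast
  then show thesis
    using that unfolding edges_between_def induced_def by auto
qed

text \<open>The ends of an \<open>E'\<close> edge lie in sets \<open>S j\<close>, and disjointness
  of the parts identifies the index.\<close>

lemma in_S_if_in_E':
  assumes "e \<in> E'" "x \<in> e" "i \<in> {1..m}" "x \<in> verts (F i)"
  shows "x \<in> S i"
proof -
  obtain j where "j \<in> {1..m}" "x \<in> S j"
    using E'_cases[OF assms(1)] assms(2) by (metis insertE singletonD)
  then show ?thesis
    using F_disjoint[of i j] S_in_F[of j x] assms(3,4) by blast
qed

lemma adj_G_iff: "adj G x y \<longleftrightarrow> (\<exists>i\<in>{1..m}. adj (F i) x y) \<or> {x, y} \<in> E'"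
  by (auto simp: adj_def edges_G)

text \<open>An \<open>E'\<close> edge joins two different parts, whereas an edge of some
  \<open>F j\<close> through \<open>y\<close> forces \<open>j = i\<close>.\<close>

lemma adj_G_cases:
  assumes "adj G x y" "i \<in> {1..m}" "y \<in> verts (F i)"
  shows "adj (F i) x y \<or> x \<notin> verts (F i) \<and> {x, y} \<in> E'"
proof (cases "{x, y} \<in> E'")
  case True
  then obtain j k a b where *: "j \<in> {1..m}" "k \<in> {1..m}" "j \<noteq> k" "a \<in> S j" "b \<in> S k"
    "{x, y} = {a, b}"
    by (rule E'_cases)
  then have "x \<notin> verts (F i)"
    using assms(2,3) S_in_F[of j a] S_in_F[of k b] F_disjoint[of j k] F_disjoint[of i j]
      F_disjoint[of i k]
    by (auto simp: doubleton_eq_iff)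
  then show ?thesis
    using True by blast
next
  case False
  then obtain j where "j \<in> {1..m}" "adj (F j) x y"
    using assms(1) adj_G_iff by blast
  then show ?thesis
    using adj_verts(2)[OF simple_F] F_disjoint[of i j] assms(2,3) by blast
qed

text \<open>Vertices outside \<open>S i\<close> are on no \<open>E'\<close> edge, so they can only
  be dominated from within their part. This serves both for universal vertices and for vertices
  missed by the neighbourhood of \<open>S i\<close>.\<close>

lemma adj_G_outside_S:
  assumes "adj G x y" "i \<in> {1..m}" "y \<in> verts (F i)" "y \<notin> S i"
  shows "adj (F i) x y"
  using adj_G_cases[OF assms(1-3)] in_S_if_in_E'[of "{x, y}" y i] assms by auto

lemma universal_not_in_S: "i \<in> {1..m} \<Longrightarrow> u \<in> universal_verts (F i) \<Longrightarrow> u \<notin> S i"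
  using univ_H S_subset by blast

lemma universal_in_F: "u \<in> universal_verts (F i) \<Longrightarrow> u \<in> verts (F i)"
  by (simp add: universal_verts_def)

text \<open>For an edge of \<open>F i\<close> this is the ASR property of the part. Any other edge
  misses all universal vertices of \<open>F i\<close>, since edges of \<open>G\<close> at these lie
  in \<open>F i\<close>.\<close>

lemma universal_avoiding:
  assumes "i \<in> {1..m}" "e \<in> edges G"
  shows "\<exists>u\<in>universal_verts (F i). u \<notin> e"
proof (cases "e \<in> edges (F i)")
  case True
  then show ?thesis
    using universal_vert_avoiding_edge F_ASR F_card F_dom assms(1) by blast
next
  case False
  obtain u where u: "u \<in> universal_verts (F i)"
    using universal_vert_exists F_dom[OF assms(1)] by blast
  obtain x y where e: "e = {x, y}" "adj G x y"
    using edge_cases[OF simple_G assms(2)] by metis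
  have "adj (F i) y x" if "x = u"
    using adj_G_outside_S[of y x i] e(2) adj_commute assms(1) that u universal_not_in_S universal_in_F
    by metis
  moreover have "adj (F i) x y" if "y = u"
    using adj_G_outside_S[of x y i] e(2) assms(1) that u universal_not_in_S universal_in_F
    by metis
  ultimately have "u \<notin> e"
    using False e(1) by (auto simp: adj_def insert_commute)
  then show ?thesis
    using u by blast
qed

text \<open>Each \<open>u i\<close> dominates its part through edges that contain \<open>u i\<close>
  and hence differ from \<open>e\<close>. Leaving \<open>e\<close> arbitrary allows
  \<open>e = {}\<close>, which covers \<open>G\<close> itself.\<close>

lemma transversal_dominating:
  assumes "\<And>i. i \<in> {1..m} \<Longrightarrow> u i \<in> universal_verts (F i) \<and> u i \<notin> e"
  shows "dominating (delete_edge G e) (u ` {1..m})"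
  unfolding dominating_iff
proof (intro conjI ballI)
  show "u ` {1..m} \<subseteq> verts (delete_edge G e)"
    using assms universal_in_F by (auto simp: verts_G)
next
  fix v assume "v \<in> verts (delete_edge G e)"
  then obtain i where i: "i \<in> {1..m}" "v \<in> verts (F i)"
    by (auto simp: verts_G)
  then have "v = u i \<or> adj (F i) (u i) v"
    using assms by (auto simp: universal_verts_def)
  then have "v = u i \<or> adj (delete_edge G e) (u i) v"
    using i assms[of i] by (auto simp: adj_G_iff)
  then show "v \<in> u ` {1..m} \<or> (\<exists>x\<in>u ` {1..m}. adj (delete_edge G e) x v)"
    using i by blast
qed

lemma domination_number_delete_edge_le:
  assumes "e \<in> edges G"
  shows "domination_number (delete_edge G e) \<le> m"
proof -
  have "\<forall>i\<in>{1..m}. \<exists>u. u \<in> universal_verts (F i) \<and> u \<notin> e"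
    using universal_avoiding assms by blast
  then obtain u where "\<forall>i\<in>{1..m}. u i \<in> universal_verts (F i) \<and> u i \<notin> e"
    by metis
  then have "domination_number (delete_edge G e) \<le> card (u ` {1..m})"
    by (intro domination_number_le transversal_dominating) blast
  also have "\<dots> \<le> m"
    using card_image_le[of "{1..m}" u] by simp
  finally show ?thesis .
qed

lemma domination_number_G: "domination_number G = m"
proof (rule antisym)
  have "\<forall>i\<in>{1..m}. \<exists>u. u \<in> universal_verts (F i)"
    using universal_vert_exists F_dom by blast
  then obtain u where "\<forall>i\<in>{1..m}. u i \<in> universal_verts (F i)"
    by metis
  \<comment> \<open>No edge is empty, so this deletion changes no adjacency.\<close>
  then have "dominating (delete_edge G {}) (u ` {1..m})"
    by (intro transversal_dominating) auto
  then have "dominating G (u ` {1..m})"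
    by (simp add: dominating_iff)
  then have "domination_number G \<le> card (u ` {1..m})"
    by (rule domination_number_le)
  also have "\<dots> \<le> m"
    using card_image_le[of "{1..m}" u] by simp
  finally show "domination_number G \<le> m" .
  show "m \<le> domination_number G"
  proof (rule domination_number_ge)
    fix D assume D: "dominating G D"
    have fin: "finite D"
      using D simple_G by (auto simp: dominating_iff finite_simple_graph_def intro: finite_subset)
    have meets: "D \<inter> verts (F i) \<noteq> {}" if i: "i \<in> {1..m}" for i
    proof -
      obtain w where w: "w \<in> universal_verts (F i)"
        using universal_vert_exists F_dom[OF i] by blast
      then have "w \<in> verts G"
        using i universal_in_F verts_G by blast
      then consider "w \<in> D" | x where "x \<in> D" "adj G x w"
        using D by (auto simp: dominating_iff)
      then show ?thesis
      proof cases
        case 1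
        then show ?thesis
          using w universal_in_F by blast
      next
        case 2
        then have "adj (F i) x w"
          using adj_G_outside_S i w universal_in_F universal_not_in_S by blast
        then show ?thesis
          using adj_verts(1)[OF simple_F[OF i]] 2 by blast
      qed
    qed
    obtain d where d: "d ` {1..m} \<subseteq> D" "card (d ` {1..m}) = card {1..m}"
      by (rule disjoint_family_transversal[OF fin meets F_disjoint])
    then show "m \<le> card D"
      using card_mono[OF fin d(1)] by simp
  qed
qed

lemma domination_number_subdivide_edge_gt:
  assumes e: "e \<in> edges G"
  shows "m < domination_number (subdivide_edge G e)"
proof -
  let ?G = "subdivide_edge G e"
  have "Suc m \<le> card D" if D: "dominating ?G D" for D
  proof (rule ccontr)
    assume "\<not> Suc m \<le> card D"
    then have card_D: "card D \<le> m"
      by simp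
    have fin: "finite D"
      using D simple_G by (auto simp: dominating_iff finite_simple_graph_def intro: finite_subset)
    have meets: "D \<inter> Some ` verts (F i) \<noteq> {}" if i: "i \<in> {1..m}" for i
    proof -
      \<comment> \<open>Since \<open>w\<close> avoids \<open>e\<close>, the subdivision vertex
        cannot dominate it.\<close>
      obtain w where w: "w \<in> universal_verts (F i)" "w \<notin> e"
        using universal_avoiding i e by blast
      then have "Some w \<in> verts ?G"
        using i universal_in_F verts_G by fastforce
      then consider "Some w \<in> D" | x where "x \<in> D" "adj ?G x (Some w)"
        using D unfolding dominating_iff by blast
      then show ?thesis
      proof cases
        case 1
        then show ?thesis
          using w universal_in_F by blast
      next
        case 2
        then obtain y where y: "x = Some y" "adj G y w"
          using w(2) by (cases x) auto
        then have "adj (F i) y w"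
          using adj_G_outside_S i w universal_in_F universal_not_in_S by blast
        then show ?thesis
          using adj_verts(1)[OF simple_F[OF i]] 2 y by blast
      qed
    qed
    have disj: "Some ` verts (F i) \<inter> Some ` verts (F j) = {}"
      if "i \<in> {1..m}" "j \<in> {1..m}" "i \<noteq> j" for i j
      using F_disjoint[OF that] by auto
    obtain d where d: "\<forall>i\<in>{1..m}. d i \<in> Some ` verts (F i)"
      and sub: "d ` {1..m} \<subseteq> D" and card_d: "card (d ` {1..m}) = card {1..m}"
      by (rule disjoint_family_transversal[OF fin meets disj])
    \<comment> \<open>The representatives already number \<open>m\<close>, so they exhaust
      \<open>D\<close>: one chosen vertex per part, and no room for \<open>None\<close>.\<close>
    have D_eq: "D = d ` {1..m}"
      using card_subset_eq[OF fin sub] card_mono[OF fin sub] card_d card_D by simp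
    have unique: "Some x = d i" if i: "i \<in> {1..m}" and x: "Some x \<in> D" "x \<in> verts (F i)" for i x
    proof -
      obtain j where j: "j \<in> {1..m}" "Some x = d j"
        using x(1) D_eq by blast
      then have "Some x \<in> Some ` verts (F j)"
        using d by simp
      then have "x \<in> verts (F j)"
        by blast
      then show ?thesis
        using F_disjoint[of i j] j i x(2) by blast
    qed
    have None_D: "None \<notin> D"
      using D_eq d by (metis imageE option.distinct(1))
    have dominated: "Some v \<in> D \<or> (\<exists>x. Some x \<in> D \<and> adj G x v \<and> {x, v} \<noteq> e)"
      if v: "v \<in> verts G" for v
    proof -
      have "Some v \<in> D \<or> (\<exists>x\<in>D. adj ?G x (Some v))"
        using D v by (auto simp: dominating_iff)
      then show ?thesis
        using None_D by (metis adj_subdivide_edge_Some option.exhaust)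
    qed
    have not_S: "x \<notin> S i" if i: "i \<in> {1..m}" and x: "Some x \<in> D" for x i
    proof
      assume xS: "x \<in> S i"
      \<comment> \<open>With \<open>x\<close> in \<open>S i\<close> as the only chosen vertex of
        part \<open>i\<close>, this \<open>v\<close> would remain undominated: it is not adjacent to
        \<open>x\<close>, and no \<open>E'\<close> edge reaches it.\<close>
      obtain v where v: "v \<in> verts (H i)" "v \<notin> closed_nbhd (H i) (S i)"
        using S_nbhd[OF i] by (auto simp: closed_nbhd_def)
      have v': "v \<notin> S i" "\<not> adj (H i) x v" "v \<in> verts (F i)"
        using v xS verts_F[OF i] by (auto simp: closed_nbhd_def)
      have d_i: "y = x" if "Some y \<in> D" "y \<in> verts (F i)" for y
        using unique[OF i that] unique[OF i x S_in_F[OF i xS]] by (metis option.inject)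
      have "v \<in> verts G"
        using v' i verts_G by blast
      then consider "Some v \<in> D" | y where "Some y \<in> D" "adj G y v"
        using dominated by blast
      then show False
      proof cases
        case 1
        then show False
          using d_i v' xS by blast
      next
        case 2
        then have "adj (F i) y v"
          using adj_G_outside_S i v' by blast
        then have "adj (F i) x v"
          using d_i adj_verts(1)[OF simple_F[OF i]] 2 by blast
        then show False
          using adj_H_if_adj_F[OF i _ v(1)] S_subset[OF i] xS v' by blast
      qed
    qed
    \<comment> \<open>Only an end of \<open>e\<close> can dominate the subdivision vertex.\<close>
    have "\<exists>x\<in>D. adj ?G x None"
      using D None_D by (auto simp: dominating_iff)
    then obtain u where u: "Some u \<in> D" "u \<in> e"
      using None_D by (metis adj_subdivide_edge_None option.exhaust)
    obtain v where v: "e = {u, v}" "u \<noteq> v" "u \<in> verts G" "v \<in> verts G" "adj G u v"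
      using edge_other_end[OF simple_G e u(2)] .
    obtain i where i: "i \<in> {1..m}" "u \<in> verts (F i)"
      using v(3) verts_G by blast
    \<comment> \<open>Otherwise the chosen vertex \<open>u\<close> would lie in \<open>S i\<close>.
      Thus \<open>e\<close> is an edge inside the part of \<open>u\<close>.\<close>
    have "e \<notin> E'"
      using in_S_if_in_E' not_S i u by blast
    then obtain j where j: "j \<in> {1..m}" "adj (F j) u v"
      using v(1,5) adj_G_iff by blast
    have v_i: "v \<in> verts (F i)"
      using adj_verts[OF simple_F j(2)] j(1) i F_disjoint[of i j] by blast
    consider "Some v \<in> D" | y where "Some y \<in> D" "adj G y v" "{y, v} \<noteq> e"
      using dominated v(4) by blast
    then show False
    proof cases
      case 1
      then show False
        using unique[OF i(1)] u(1) i(2) v_i v(2) by (metis option.inject)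
    next
      case 2
      \<comment> \<open>The only chosen vertex of part \<open>i\<close> is \<open>u\<close>, whose
        edge to \<open>v\<close> has been subdivided. Hence \<open>y\<close> reaches
        \<open>v\<close> through \<open>E'\<close>, which puts a chosen vertex into some
        \<open>S k\<close>.\<close>
      then have "y \<notin> verts (F i)"
        using unique[OF i(1)] u(1) i(2) v(1) by (metis option.inject)
      then have yv: "{y, v} \<in> E'"
        using adj_G_cases[OF 2(2) i(1) v_i] adj_verts(1)[OF simple_F[OF i(1)]] by blast
      obtain k where "k \<in> {1..m}" "y \<in> verts (F k)"
        using adj_verts(1)[OF simple_G 2(2)] verts_G by blast
      then show False
        using in_S_if_in_E'[OF yv] not_S 2(1) by blast
    qed
  qed
  then show ?thesis
    using domination_number_ge[of ?G "Suc m"] by (simp add: Suc_le_eq)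
qed

end

theorem proposition20:
  fixes m :: nat and G :: "'a sgraph"
  assumes "m \<ge> 1" and "G \<in> family_B m"
  shows "ASR_graph G \<and> domination_number G = m"
proof -
  have "\<exists>F H S E'. B_decomposition m G F H S E'"
    using assms(2) unfolding family_B_def mem_Collect_eq
  proof (elim conjE exE, goal_cases)
    case (1 F H S E')
    then have "B_decomposition m G F H S E'"
      by unfold_locales meson+
    then show ?case
      by blast
  qed
  then obtain F H :: "nat \<Rightarrow> 'a sgraph" and S :: "nat \<Rightarrow> 'a set" and E' :: "'a set set"
    where "B_decomposition m G F H S E'"
    by blast
  then interpret B_decomposition m G F H S E' .
  have "connected_graph G"
    using assms(2) by (simp add: family_B_def)
  moreover have "card (verts G) \<ge> 2"
  proof -
    \<comment> \<open>Part 1 exists because \<open>m\<close> is positive, and it alone has three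
      vertices.\<close>
    have "verts (F 1) \<subseteq> verts G" "finite (verts G)"
      using assms(1) verts_G simple_G by (auto simp: finite_simple_graph_def)
    then show ?thesis
      using card_mono[of "verts G" "verts (F 1)"] F_card[of 1] assms(1) by simp
  qed
  \<comment> \<open>The number \<open>m\<close> separates the two values: at most \<open>m\<close>
    after deletion, more than \<open>m\<close> after subdivision.\<close>
  moreover have "domination_number (delete_edge G e) \<noteq> domination_number (subdivide_edge G e)"
    if "e \<in> edges G" for e
    using domination_number_delete_edge_le[OF that] domination_number_subdivide_edge_gt[OF that]
    by simp
  ultimately show ?thesis
    using simple_G domination_number_G by (simp add: ASR_graph_def)
qed

end
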